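(* For every Rec program $\langle S,T\rangle$, $[\![\mathsf{stf}_{\varnothing}(S)]\!] = \mathcal{S}_{tr}[\![S]\!]$.
   Context: Rec programs: a pair $\langle S,T\rangle$ with $S ::= \mathbf{skip} \mid x := a \mid S_1;S_2 \mid \mathbf{if}\ b\ \mathbf{then}\ S_1\ \mathbf{else}\ S_2 \mid m()$ and $T$ a finite list of declarations $m\,\{S_m\}$ of parameterless procedures with unique names; only declared procedures are called. $a$, $b$ are side-effect-free arithmetic/Boolean expressions over global integer variables; $\mathbf{State}$ = maps from variables to $\mathbb{Z}$; $\mathcal{A}[\![a]\!](s)$, $\mathcal{B}[\![b]\!](s)$ denote evaluation; $\mathbf{State}^+$ = nonempty finite state sequences. Trace semantics of Rec: for $A,B\subseteq\mathbf{State}^+$, $A|_b=\{s\cdot\sigma\in A:\mathcal{B}[\![b]\!](s)=\mathbf{tt}\}$, $\sharp A=\{s\cdot s\cdot\sigma:s\cdot\sigma\in A\}$, $A\frown B=\{\sigma_A\cdot s\cdot\sigma_B:\sigma_A\cdot s\in A, s\cdot\sigma_B\in B\}$. With procedures $m_1,\dots,m_n$ declared as $m_i\,\{S_i\}$ and $\rho$ mapping procedure names to trace sets: $\mathcal{S}_{tr}[\![\mathbf{skip}]\!]_\rho=\{s\cdot s\}$, $\mathcal{S}_{tr}[\![x:=a]\!]_\rho=\{s\cdot s[x\mapsto\mathcal{A}[\![a]\!](s)]\}$, sequencing is $\frown$, $\mathcal{S}_{tr}[\![\mathbf{if}\ b\ \mathbf{then}\ S_1\ \mathbf{else}\ S_2]\!]_\rho=(\sharp\mathcal{S}_{tr}[\![S_1]\!]_\rho)|_b\cup(\sharp\mathcal{S}_{tr}[\![S_2]\!]_\rho)|_{\neg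 b}$, $\mathcal{S}_{tr}[\![m_i()]\!]_\rho=\rho(m_i)$; $\rho_0$ is the least fixed point (pointwise inclusion) of $H(\rho)=(\sharp\mathcal{S}_{tr}[\![S_1]\!]_\rho,\dots,\sharp\mathcal{S}_{tr}[\![S_n]\!]_\rho)$ and $\mathcal{S}_{tr}[\![S]\!]=\mathcal{S}_{tr}[\![S]\!]_{\rho_0}$. Trace formulas: $\phi ::= p \mid R \mid X \mid \phi_1\wedge\phi_2 \mid \phi_1\vee\phi_2 \mid \phi_1\frown\phi_2 \mid \mu X.\phi$, with $p$ state formulas (including Boolean expressions), $R$ binary relation symbols, $X$ recursion variables. Semantics relative to a valuation $\mathcal{V}$: $[\![p]\!]=\{s\cdot\sigma:s\models p\}$, $[\![R]\!]=\{s\cdot s':R(s,s')\}$, $[\![X]\!]=\mathcal{V}(X)$, $\wedge,\vee$ as $\cap,\cup$, $\frown$ as the chop $A\frown B$ above, $[\![\mu X.\phi]\!]_{\mathcal{V}}=\bigcap\{\gamma:[\![\phi]\!]_{\mathcal{V}[X\mapsto\gamma]}\subseteq\gamma\}$; for closed formulas the valuation is irrelevant and omitted. Relation symbols used: $\mathit{Id}(s,s')$ iff $s'=s$; $\mathit{Sb}^a_x(s,s')$ iff $s'=s[x\mapsto\mathcal{A}[\![a]\!](s)]$. Strongest trace formula: for a set $\overline{X}$ of procedure names, $\mathsf{stf}_{\overline{X}}(\mathbf{skip})=\mathit{Id}$, $\mathsf{stf}_{\overline{X}}(x:=a)=\mathit{Sb}^a_x$, $\mathsf{stf}_{\overline{X}}(S_1;S_2)=\mathsf{stf}_{\overline{X}}(S_1)\frown\mathsf{stf}_{\overline{X}}(S_2)$,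 $\mathsf{stf}_{\overline{X}}(\mathbf{if}\ b\ \mathbf{then}\ S_1\ \mathbf{else}\ S_2)=(b\wedge(\mathit{Id}\frown\mathsf{stf}_{\overline{X}}(S_1)))\vee(\neg b\wedge(\mathit{Id}\frown\mathsf{stf}_{\overline{X}}(S_2)))$, and $\mathsf{stf}_{\overline{X}}(m())=\mathit{Id}\frown\mu X_m.\,\mathsf{stf}_{\overline{X}\cup\{m\}}(S_m)$ if $m\notin\overline{X}$ and $m\,\{S_m\}\in T$, and $\mathit{Id}\frown X_m$ otherwise, where $X_m$ is a recursion variable associated with $m$. *)

theory Defs
  imports Main
begin

section \<open>States and traces\<close>

type_synonym 'v state = "'v \<Rightarrow> int"

typedef 's trace = "{\<sigma> :: 's list. \<sigma> \<noteq> []}"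
  morphisms states_of trace_of
  by blast

text \<open>The arguments of \<open>trace_of\<close> below are all visibly nonempty lists:
  \<open>trace_of (s # \<sigma>)\<close> renders \<open>s \<cdot> \<sigma>\<close> (with \<open>\<sigma>\<close> possibly empty), and
  \<open>trace_of (\<sigma> @ [s])\<close> renders \<open>\<sigma> \<cdot> s\<close>.\<close>

definition restrict :: "('s \<Rightarrow> bool) \<Rightarrow> 's trace set \<Rightarrow> 's trace set" where
  "restrict P A = {trace_of (s # \<sigma>) | s \<sigma>. trace_of (s # \<sigma>) \<in> A \<and> P s}"

definition sharp :: "'s trace set \<Rightarrow> 's trace set" where
  "sharp A = {trace_of (s # s # \<sigma>) | s \<sigma>. trace_of (s # \<sigma>) \<in> A}"

definition chop :: "'s trace set \<Rightarrow> 's trace set \<Rightarrow> 's trace set" (infixr \<open>\<frown>\<close> 75) where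
  "A \<frown> B = {trace_of (\<sigma>A @ [s] @ \<sigma>B) | \<sigma>A s \<sigma>B.
      trace_of (\<sigma>A @ [s]) \<in> A \<and> trace_of (s # \<sigma>B) \<in> B}"


section \<open>Rec programs\<close>

text \<open>The languages of arithmetic and Boolean expressions are left open: they are types
  \<open>'a\<close> and \<open>'b\<close>, given together with evaluation functions
  \<open>aval :: 'a \<Rightarrow> 'v state \<Rightarrow> int\<close> and \<open>bval :: 'b \<Rightarrow> 'v state \<Rightarrow> bool\<close>. Program variables
  are of type \<open>'v\<close>, procedure names of type \<open>'p\<close>.\<close>

datatype ('v, 'a, 'b, 'p) stmt =
    Skip
  | Assign 'v 'a
  | Seq "('v, 'a, 'b, 'p) stmt" "('v, 'a, 'b, 'p) stmt"
  | Cond 'b "('v, 'a, 'b, 'p) stmt" "('v, 'a, 'b, 'p) stmt"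
  | Call 'p

type_synonym ('v, 'a, 'b, 'p) decls = "('p \<times> ('v, 'a, 'b, 'p) stmt) list"

primrec calls :: "('v, 'a, 'b, 'p) stmt \<Rightarrow> 'p set" where
  "calls Skip = {}"
| "calls (Assign x a) = {}"
| "calls (Seq S1 S2) = calls S1 \<union> calls S2"
| "calls (Cond b S1 S2) = calls S1 \<union> calls S2"
| "calls (Call m) = {m}"

definition rec_program :: "('v, 'a, 'b, 'p) stmt \<Rightarrow> ('v, 'a, 'b, 'p) decls \<Rightarrow> bool" where
  "rec_program S T \<longleftrightarrow>
     distinct (map fst T) \<and>
     calls S \<subseteq> fst ` set T \<and>
     (\<forall>(m, Sm) \<in> set T. calls Sm \<subseteq> fst ` set T)"


section \<open>Trace semantics\<close>

primrec trace_sem_env ::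
  "('a \<Rightarrow> 'v state \<Rightarrow> int) \<Rightarrow> ('b \<Rightarrow> 'v state \<Rightarrow> bool) \<Rightarrow> ('p \<Rightarrow> 'v state trace set) \<Rightarrow>
   ('v, 'a, 'b, 'p) stmt \<Rightarrow> 'v state trace set" where
  "trace_sem_env aval bval \<rho> Skip = {trace_of [s, s] | s. True}"
| "trace_sem_env aval bval \<rho> (Assign x a) = {trace_of [s, s(x := aval a s)] | s. True}"
| "trace_sem_env aval bval \<rho> (Seq S1 S2) =
     trace_sem_env aval bval \<rho> S1 \<frown> trace_sem_env aval bval \<rho> S2"
| "trace_sem_env aval bval \<rho> (Cond b S1 S2) =
     restrict (bval b) (sharp (trace_sem_env aval bval \<rho> S1)) \<union>
     restrict (\<lambda>s. \<not> bval b s) (sharp (trace_sem_env aval bval \<rho> S2))"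
| "trace_sem_env aval bval \<rho> (Call m) = \<rho> m"

text \<open>Environments are total functions, so the tuple of declared procedures is padded with
  the empty set at undeclared names, which a Rec program never calls.\<close>

definition proc_transformer ::
  "('a \<Rightarrow> 'v state \<Rightarrow> int) \<Rightarrow> ('b \<Rightarrow> 'v state \<Rightarrow> bool) \<Rightarrow> ('v, 'a, 'b, 'p) decls \<Rightarrow>
   ('p \<Rightarrow> 'v state trace set) \<Rightarrow> ('p \<Rightarrow> 'v state trace set)" where
  "proc_transformer aval bval T \<rho> = (\<lambda>m. case map_of T m of
      Some Sm \<Rightarrow> sharp (trace_sem_env aval bval \<rho> Sm)
    | None \<Rightarrow> {})"

lemma restrict_mono: "A \<subseteq> A' \<Longrightarrow> restrict P A \<subseteq> restrict P A'"
  unfolding restrict_def by blast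

lemma sharp_mono: "A \<subseteq> A' \<Longrightarrow> sharp A \<subseteq> sharp A'"
  unfolding sharp_def by blast

lemma chop_mono: "A \<subseteq> A' \<Longrightarrow> B \<subseteq> B' \<Longrightarrow> A \<frown> B \<subseteq> A' \<frown> B'"
  unfolding chop_def by blast

lemma trace_sem_env_mono:
  "\<rho> \<le> \<rho>' \<Longrightarrow> trace_sem_env aval bval \<rho> S \<subseteq> trace_sem_env aval bval \<rho>' S"
proof (induction S)
  case (Seq S1 S2)
  then show ?case by (simp add: chop_mono)
next
  case (Cond b S1 S2)
  then show ?case by (simp only: trace_sem_env.simps) (intro Un_mono restrict_mono sharp_mono; simp)
next
  case (Call m)
  then show ?case by (simp add: le_fun_def)
qed simp_all

text \<open>Monotonicity makes \<open>lfp\<close> below the least fixed point.\<close>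

lemma mono_proc_transformer: "mono (proc_transformer aval bval T)"
  unfolding proc_transformer_def
  by (intro monoI le_funI) (auto split: option.splits dest: sharp_mono[OF trace_sem_env_mono])

definition trace_sem ::
  "('a \<Rightarrow> 'v state \<Rightarrow> int) \<Rightarrow> ('b \<Rightarrow> 'v state \<Rightarrow> bool) \<Rightarrow> ('v, 'a, 'b, 'p) decls \<Rightarrow>
   ('v, 'a, 'b, 'p) stmt \<Rightarrow> 'v state trace set" where
  "trace_sem aval bval T S = trace_sem_env aval bval (lfp (proc_transformer aval bval T)) S"


section \<open>Trace formulas\<close>

datatype 'b sform = SBool 'b | SNot "'b sform" | SAnd "'b sform" "'b sform"

primrec sform_sat :: "('b \<Rightarrow> 'v state \<Rightarrow> bool) \<Rightarrow> 'v state \<Rightarrow> 'b sform \<Rightarrow> bool" where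
  "sform_sat bval s (SBool b) = bval b s"
| "sform_sat bval s (SNot p) = (\<not> sform_sat bval s p)"
| "sform_sat bval s (SAnd p q) = (sform_sat bval s p \<and> sform_sat bval s q)"

datatype ('v, 'a) relsym = Id_rel | Sb_rel 'v 'a

primrec rel_holds ::
  "('a \<Rightarrow> 'v state \<Rightarrow> int) \<Rightarrow> ('v, 'a) relsym \<Rightarrow> 'v state \<Rightarrow> 'v state \<Rightarrow> bool" where
  "rel_holds aval Id_rel s s' = (s' = s)"
| "rel_holds aval (Sb_rel x a) s s' = (s' = s(x := aval a s))"

datatype ('v, 'a, 'b, 'x) tform =
    TState "'b sform"
  | TRel "('v, 'a) relsym"
  | TVar 'x
  | TAnd "('v, 'a, 'b, 'x) tform" "('v, 'a, 'b, 'x) tform"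
  | TOr "('v, 'a, 'b, 'x) tform" "('v, 'a, 'b, 'x) tform"
  | TChop "('v, 'a, 'b, 'x) tform" "('v, 'a, 'b, 'x) tform"
  | TMu 'x "('v, 'a, 'b, 'x) tform"

primrec tform_sem ::
  "('a \<Rightarrow> 'v state \<Rightarrow> int) \<Rightarrow> ('b \<Rightarrow> 'v state \<Rightarrow> bool) \<Rightarrow> ('v, 'a, 'b, 'x) tform \<Rightarrow>
   ('x \<Rightarrow> 'v state trace set) \<Rightarrow> 'v state trace set" where
  "tform_sem aval bval (TState p) V = {trace_of (s # \<sigma>) | s \<sigma>. sform_sat bval s p}"
| "tform_sem aval bval (TRel R) V = {trace_of [s, s'] | s s'. rel_holds aval R s s'}"
| "tform_sem aval bval (TVar X) V = V X"
| "tform_sem aval bval (TAnd \<phi> \<psi>) V = tform_sem aval bval \<phi> V \<inter> tform_sem aval bval \<psi> V"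
| "tform_sem aval bval (TOr \<phi> \<psi>) V = tform_sem aval bval \<phi> V \<union> tform_sem aval bval \<psi> V"
| "tform_sem aval bval (TChop \<phi> \<psi>) V = tform_sem aval bval \<phi> V \<frown> tform_sem aval bval \<psi> V"
| "tform_sem aval bval (TMu X \<phi>) V = \<Inter> {\<gamma>. tform_sem aval bval \<phi> (V(X := \<gamma>)) \<subseteq> \<gamma>}"


section \<open>Strongest trace formula\<close>

text \<open>Procedure names double as recursion variables: \<open>X\<^sub>m\<close> is \<open>TVar m\<close>.\<close>

function stf ::
  "('v, 'a, 'b, 'p) decls \<Rightarrow> 'p set \<Rightarrow> ('v, 'a, 'b, 'p) stmt \<Rightarrow> ('v, 'a, 'b, 'p) tform" where
  "stf T X Skip = TRel Id_rel"
| "stf T X (Assign x a) = TRel (Sb_rel x a)"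
| "stf T X (Seq S1 S2) = TChop (stf T X S1) (stf T X S2)"
| "stf T X (Cond b S1 S2) =
     TOr (TAnd (TState (SBool b)) (TChop (TRel Id_rel) (stf T X S1)))
         (TAnd (TState (SNot (SBool b))) (TChop (TRel Id_rel) (stf T X S2)))"
| "stf T X (Call m) =
     (if m \<in> X then TChop (TRel Id_rel) (TVar m)
      else (case map_of T m of
          Some Sm \<Rightarrow> TChop (TRel Id_rel) (TMu m (stf T (insert m X) Sm))
        | None \<Rightarrow> TChop (TRel Id_rel) (TVar m)))"
  by pat_completeness auto

termination
proof (relation "(\<lambda>(T, X, S). card (fst ` set T - X)) <*mlex*> measure (\<lambda>(T, X, S). size S)",
       goal_cases)
  case 1
  then show ?case by (simp add: wf_mlex)
next
  case (6 T X m Sm)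
  then have "m \<in> fst ` set T - X" by (force dest: map_of_SomeD)
  then have "fst ` set T - insert m X \<subset> fst ` set T - X" by blast
  then have "card (fst ` set T - insert m X) < card (fst ` set T - X)"
    by (intro psubset_card_mono) simp_all
  then show ?case by (simp add: mlex_less)
qed (simp_all add: mlex_leq)

end

(* The semantics of a strongest trace formula with free variables X is the program semantics in
   which the bodies of the procedures in X are frozen to the valuation and only the remaining
   procedures are solved for by a simultaneous least fixed point. Unfolding a call m() adds a
   single-variable fixed point for m on top of the one for the procedures outside X and m; that
   the two together give the simultaneous fixed point outside X is Bekic's principle. *)

theory Submission
  imports Defs
begin

lemma trace_of_inject_Nil:
  "\<sigma> \<noteq> [] \<Longrightarrow> \<tau> \<noteq> [] \<Longrightarrow> trace_of \<sigma> = trace_of \<tau> \<longleftrightarrow> \<sigma> = \<tau>"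
  by (simp add: trace_of_inject)

text \<open>A trace of \<open>Id_rel\<close> is one state repeated, so gluing a trace of
  \<open>A\<close> onto its last state doubles the first state of that trace. This matches the
  leading \<open>Id_rel\<close> in calls and branches with \<open>sharp\<close>.\<close>

lemma tform_sem_Id_chop: "tform_sem aval bval (TRel Id_rel) V \<frown> A = sharp A"
proof (intro set_eqI iffI)
  fix t assume "t \<in> tform_sem aval bval (TRel Id_rel) V \<frown> A"
  then obtain \<sigma> s \<tau> u where t: "t = trace_of (\<sigma> @ [s] @ \<tau>)"
    and Id: "trace_of (\<sigma> @ [s]) = trace_of [u, u]" and A: "trace_of (s # \<tau>) \<in> A"
    unfolding chop_def by auto
  from Id have "\<sigma> @ [s] = [u] @ [u]" by (simp add: trace_of_inject_Nil)
  then have "\<sigma> = [s]" by (simp only: append1_eq_conv)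
  with t A show "t \<in> sharp A" unfolding sharp_def by auto
next
  fix t assume "t \<in> sharp A"
  then obtain s \<tau> where "t = trace_of ([s] @ [s] @ \<tau>)" "trace_of (s # \<tau>) \<in> A"
    unfolding sharp_def by auto
  moreover have "trace_of ([s] @ [s]) \<in> tform_sem aval bval (TRel Id_rel) V" by auto
  ultimately show "t \<in> tform_sem aval bval (TRel Id_rel) V \<frown> A"
    unfolding chop_def by blast
qed

lemma tform_sem_TState_Int:
  "tform_sem aval bval (TState p) V \<inter> A = restrict (\<lambda>s. sform_sat bval s p) A"
  unfolding restrict_def by (auto simp: trace_of_inject_Nil)

text \<open>The recursion variable of \<open>m\<close> stands for the traces of the body alone,
  since a call puts \<open>Id_rel\<close> in front of it, whereas a program environment already
  includes the stutter of the call. Hence \<open>sharp (V m)\<close> and not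
  \<open>V m\<close>.\<close>

definition frozen_transformer ::
  "('a \<Rightarrow> 'v state \<Rightarrow> int) \<Rightarrow> ('b \<Rightarrow> 'v state \<Rightarrow> bool) \<Rightarrow> ('v, 'a, 'b, 'p) decls \<Rightarrow>
   'p set \<Rightarrow> ('p \<Rightarrow> 'v state trace set) \<Rightarrow>
   ('p \<Rightarrow> 'v state trace set) \<Rightarrow> ('p \<Rightarrow> 'v state trace set)" where
  "frozen_transformer aval bval T X V \<rho> =
     (\<lambda>m. if m \<in> X then sharp (V m) else proc_transformer aval bval T \<rho> m)"

lemma mono_frozen_transformer: "mono (frozen_transformer aval bval T X V)"
  unfolding frozen_transformer_def
  by (intro monoI le_funI) (simp add: le_funD[OF monoD[OF mono_proc_transformer]])

text \<open>This is why the closed formula has the same value at every \<open>V\<close>.\<close>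

lemma frozen_transformer_empty:
  "frozen_transformer aval bval T {} V = proc_transformer aval bval T"
  by (simp add: frozen_transformer_def fun_eq_iff)

lemma lfp_frozen_transformer:
  "lfp (frozen_transformer aval bval T X V) m =
     (if m \<in> X then sharp (V m)
      else proc_transformer aval bval T (lfp (frozen_transformer aval bval T X V)) m)"
  by (subst lfp_unfold[OF mono_frozen_transformer]) (simp add: frozen_transformer_def)

text \<open>Each inclusion turns a solution of one system into a pre-fixed point of the other: the
  fixed point with \<open>m\<close> solved for also serves when \<open>m\<close> is frozen at its
  own solution, and a \<open>\<gamma>\<close> closed under the body of \<open>m\<close> yields a
  pre-fixed point of the transformer that solves for \<open>m\<close>.\<close>

lemma frozen_transformer_bekic:
  assumes m: "m \<notin> X" "map_of T m = Some Sm"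
  shows "\<Inter> {\<gamma>. trace_sem_env aval bval
                (lfp (frozen_transformer aval bval T (insert m X) (V(m := \<gamma>)))) Sm \<subseteq> \<gamma>}
       = trace_sem_env aval bval (lfp (frozen_transformer aval bval T X V)) Sm"
proof -
  let ?\<rho> = "lfp (frozen_transformer aval bval T X V)"
  let ?\<rho>' = "\<lambda>\<gamma>. lfp (frozen_transformer aval bval T (insert m X) (V(m := \<gamma>)))"
  let ?sem = "\<lambda>\<rho>. trace_sem_env aval bval \<rho> Sm"
  have "?\<rho> m = sharp (?sem ?\<rho>)"
    using m by (subst lfp_frozen_transformer) (simp add: proc_transformer_def)
  moreover have "?\<rho> k = (if k \<in> X then sharp (V k) else proc_transformer aval bval T ?\<rho> k)" for k
    by (rule lfp_frozen_transformer)
  ultimately have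
    "frozen_transformer aval bval T (insert m X) (V(m := ?sem ?\<rho>)) ?\<rho> \<le> ?\<rho>"
    using m(1) by (intro le_funI, subst frozen_transformer_def) (auto split: if_splits)
  then have prefixed: "?sem (?\<rho>' (?sem ?\<rho>)) \<subseteq> ?sem ?\<rho>"
    by (intro trace_sem_env_mono lfp_lowerbound)
  have least: "?sem ?\<rho> \<subseteq> \<gamma>" if \<gamma>: "?sem (?\<rho>' \<gamma>) \<subseteq> \<gamma>" for \<gamma>
  proof -
    have \<rho>': "?\<rho>' \<gamma> k = (if k \<in> insert m X then sharp ((V(m := \<gamma>)) k)
        else proc_transformer aval bval T (?\<rho>' \<gamma>) k)" for k
      by (rule lfp_frozen_transformer)
    \<comment> \<open>Away from \<open>m\<close> the two transformers agree and equality holds; only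
      at \<open>m\<close> is the closure of \<open>\<gamma>\<close> under the body needed.\<close>
    have "frozen_transformer aval bval T X V (?\<rho>' \<gamma>) k \<le> ?\<rho>' \<gamma> k" for k
    proof (cases "k = m")
      case True
      have "frozen_transformer aval bval T X V (?\<rho>' \<gamma>) m = sharp (?sem (?\<rho>' \<gamma>))"
        using m by (simp add: frozen_transformer_def proc_transformer_def)
      also have "\<dots> \<subseteq> sharp \<gamma>" by (rule sharp_mono[OF \<gamma>])
      also have "\<dots> = ?\<rho>' \<gamma> m" by (subst \<rho>') simp
      finally show ?thesis using True by simp
    next
      case False
      then show ?thesis using \<rho>'[of k] by (simp add: frozen_transformer_def)
    qed
    then have "?\<rho> \<le> ?\<rho>' \<gamma>" by (intro lfp_lowerbound le_funI)
    then show ?thesis using \<gamma> trace_sem_env_mono by blast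
  qed
  from prefixed least show ?thesis by (intro antisym Inter_lower Inter_greatest) auto
qed

text \<open>The induction follows the recursion of \<open>stf\<close>, which enters a body with its
  procedure added to \<open>X\<close>. The valuation stays arbitrary because the formula under a
  fixed point is evaluated at \<open>V(m := \<gamma>)\<close> for every
  \<open>\<gamma>\<close>.\<close>

lemma tform_sem_stf:
  assumes "calls S \<subseteq> fst ` set T" and "\<forall>(m, Sm) \<in> set T. calls Sm \<subseteq> fst ` set T"
  shows "tform_sem aval bval (stf T X S) V =
    trace_sem_env aval bval (lfp (frozen_transformer aval bval T X V)) S"
  using assms
proof (induction T X S arbitrary: V rule: stf.induct)
  case (1 T X)
  then show ?case by simp
next
  case (2 T X x a)
  then show ?case by simp
next
  case (3 T X S1 S2)
  then show ?case by simp
next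
  case (4 T X b S1 S2)
  then show ?case
    \<comment> \<open>\<open>TState\<close> and \<open>TRel\<close> stay folded so that the lemmas
      on them can match.\<close>
    by (simp add: tform_sem_Id_chop tform_sem_TState_Int del: tform_sem.simps(1,2))
next
  case (5 T X m)
  let ?\<rho> = "lfp (frozen_transformer aval bval T X V)"
  show ?case
  proof (cases "m \<in> X")
    case True
    then have "?\<rho> m = sharp (V m)" by (simp add: lfp_frozen_transformer)
    with True show ?thesis by (simp add: tform_sem_Id_chop del: tform_sem.simps(2))
  next
    case False
    \<comment> \<open>Calls reach declared procedures only, which excludes the branch of
      \<open>stf\<close> that leaves an undeclared \<open>m\<close> as a free variable.\<close>
    from "5.prems"(1) obtain Sm where Sm: "map_of T m = Some Sm"
      by (auto simp: image_iff dest: weak_map_of_SomeI)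
    then have "calls Sm \<subseteq> fst ` set T" using "5.prems"(2) by (fast dest: map_of_SomeD)
    then have IH: "tform_sem aval bval (stf T (insert m X) Sm) W =
        trace_sem_env aval bval (lfp (frozen_transformer aval bval T (insert m X) W)) Sm" for W
      using "5.IH"[OF False Sm] "5.prems"(2) by blast
    have "?\<rho> m = sharp (trace_sem_env aval bval ?\<rho> Sm)"
      using False Sm by (subst lfp_frozen_transformer) (simp add: proc_transformer_def)
    \<comment> \<open>By \<open>IH\<close> the fixed point formula becomes the intersection in
      \<open>frozen_transformer_bekic\<close>, and the leading \<open>Id_rel\<close> supplies the
      \<open>sharp\<close>.\<close>
    then show ?thesis
      using False Sm
      by (simp add: tform_sem_Id_chop IH frozen_transformer_bekic del: tform_sem.simps(2))
  qed
qed

theorem mainTheorem3: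
  fixes aval :: "'a \<Rightarrow> 'v state \<Rightarrow> int"
    and bval :: "'b \<Rightarrow> 'v state \<Rightarrow> bool"
    and S :: "('v, 'a, 'b, 'p) stmt"
    and T :: "('v, 'a, 'b, 'p) decls"
    and V :: "'p \<Rightarrow> 'v state trace set"
  assumes "rec_program S T"
  shows "tform_sem aval bval (stf T {} S) V = trace_sem aval bval T S"
  using assms unfolding rec_program_def trace_sem_def
  by (simp add: tform_sem_stf frozen_transformer_empty)

end
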